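(* Let $w$ be the velocity trajectory, on $[0,\infty)$, of the system $J\dot w=-F+u$ with LuGre friction $$\dot z = w-\sigma_0\frac{|w|}{h(w)}z,\qquad F=\sigma_0 z+\sigma_1\dot z+F_v w,\qquad h(w)=F_c+(F_s-F_c)e^{-(w/w_s)^2},$$ for an arbitrary input $u$, and consider the observer $$\dot{\hat z}=w-\sigma_0\frac{|w|}{h(w)}\hat z+K_1(w-\hat w),\qquad J\dot{\hat w}=-\sigma_0\hat z-\sigma_1\dot{\hat z}-F_v w+u+K_2(w-\hat w),$$ with (time-varying) gains $$K_1=\frac{C\sigma_0}{AJ}\left(\sigma_1\frac{|w|}{h(w)}-1\right),\qquad K_2=\alpha+\sigma_1K_1,$$ where $A>0$, $C>0$, $\alpha>0$ are arbitrary constants. Let $e_z=z-\hat z$ and $e_w=w-\hat w$. 1. If $w\in L_\infty$, then $e_w(t)\to 0$ as $t\to\infty$. 2. If either there is $a>0$ with $|w(t)|\ge a$ for all $t\ge 0$, or there are $T>0$ and $b>0$ with $\int_t^{t+T}|w(\tau)|\,d\tau\ge b$ for all $t\ge 0$, then the observer error dynamics $$\dot e_z=-\sigma_0\frac{|w|}{h(w)}e_z-K_1e_w,\qquad \dot e_w=-\frac{\sigma_0}{J}e_z+\frac{\sigma_0\sigma_1}{J}\frac{|w|}{h(w)}e_z-K_3e_w,\qquad K_3=\frac{K_2-\sigma_1K_1}{J}=\frac{\alpha}{J},$$ are exponentially stable.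
   Context: All functions are real-valued functions of time $t\ge 0$; $L_\infty$ denotes the bounded functions on $[0,\infty)$. The constants $J$ (inertia), $\sigma_0$ (stiffness), $\sigma_1$ (damping), $F_c$ (Coulomb friction), $F_s$ (stiction), $w_s$ (Stribeck velocity) are positive, and $F_v$ (viscous coefficient) is a known constant. The velocity $w$ is measured; the internal state $z$ is not. The trajectories $w,z$ are assumed to exist on $[0,\infty)$. The error dynamics are a linear time-varying system with $w=w(t)$ regarded as a given signal. Exponential stability of such a system with state $e$ means: there exist $k,\delta>0$ such that every solution satisfies $\|e(t)\|\le k e^{-\delta(t-t_0)}\|e(t_0)\|$ for all $t\ge t_0\ge 0$. *)

theory Defs
  imports "HOL-Analysis.Analysis"
begin

definition stribeck :: "real \<Rightarrow> real \<Rightarrow> real \<Rightarrow> real \<Rightarrow> real" where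
  "stribeck Fc Fs ws v = Fc + (Fs - Fc) * exp (- ((v / ws)\<^sup>2))"

definition bristle_rate :: "real \<Rightarrow> (real \<Rightarrow> real) \<Rightarrow> real \<Rightarrow> real \<Rightarrow> real" where
  "bristle_rate \<sigma>0 h v \<zeta> = v - \<sigma>0 * (\<bar>v\<bar> / h v) * \<zeta>"

(* The equation c * x' = f on [0,\<infinity>) in integrated form.  It is used for the two velocity
   equations only: they contain the arbitrary input u, which need not be continuous, so their
   solutions need not be differentiable everywhere.  Classical solutions are a special case
   (next lemma). *)
definition solves_integrated :: "real \<Rightarrow> (real \<Rightarrow> real) \<Rightarrow> (real \<Rightarrow> real) \<Rightarrow> bool" where
  "solves_integrated c x f \<longleftrightarrow> (\<forall>t\<ge>0. (f has_integral c * (x t - x 0)) {0..t})"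

lemma solves_integrated_if_classical:
  assumes "\<And>t. t \<ge> 0 \<Longrightarrow> (x has_real_derivative x' t) (at t within {0..})"
    and "\<And>t. t \<ge> 0 \<Longrightarrow> c * x' t = f t"
  shows "solves_integrated c x f"
  unfolding solves_integrated_def
proof (intro allI impI)
  fix t :: real assume t: "0 \<le> t"
  have "((\<lambda>s. c * x s) has_vector_derivative f s) (at s within {0..t})" if "s \<in> {0..t}" for s
  proof -
    have "(x has_real_derivative x' s) (at s within {0..t})"
      by (rule DERIV_subset[OF assms(1)]) (use that in auto)
    then have "((\<lambda>s. c * x s) has_real_derivative c * x' s) (at s within {0..t})"
      by (rule DERIV_cmult)
    then show ?thesis
      using assms(2)[of s] that by (simp add: has_real_derivative_iff_has_vector_derivative)
  qed
  from fundamental_theorem_of_calculus[OF t this]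
  show "(f has_integral c * (x t - x 0)) {0..t}"
    by (simp add: right_diff_distrib)
qed

definition lugre_trajectory ::
  "real \<Rightarrow> real \<Rightarrow> real \<Rightarrow> real \<Rightarrow> (real \<Rightarrow> real) \<Rightarrow> (real \<Rightarrow> real) \<Rightarrow> (real \<Rightarrow> real) \<Rightarrow> (real \<Rightarrow> real) \<Rightarrow> bool"
where
  "lugre_trajectory J \<sigma>0 \<sigma>1 Fv h u w z \<longleftrightarrow>
     (let zdot = (\<lambda>t. bristle_rate \<sigma>0 h (w t) (z t));
          F = (\<lambda>t. \<sigma>0 * z t + \<sigma>1 * zdot t + Fv * w t)
      in (\<forall>t\<ge>0. (z has_real_derivative zdot t) (at t within {0..})) \<and>
         solves_integrated J w (\<lambda>t. - F t + u t))"

definition observer_trajectory ::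
  "real \<Rightarrow> real \<Rightarrow> real \<Rightarrow> real \<Rightarrow> (real \<Rightarrow> real) \<Rightarrow> (real \<Rightarrow> real) \<Rightarrow> (real \<Rightarrow> real) \<Rightarrow>
   (real \<Rightarrow> real) \<Rightarrow> (real \<Rightarrow> real) \<Rightarrow> (real \<Rightarrow> real) \<Rightarrow> (real \<Rightarrow> real) \<Rightarrow> bool"
where
  "observer_trajectory J \<sigma>0 \<sigma>1 Fv h K1 K2 u w zh wh \<longleftrightarrow>
     (let zhdot = (\<lambda>t. bristle_rate \<sigma>0 h (w t) (zh t) + K1 t * (w t - wh t))
      in (\<forall>t\<ge>0. (zh has_real_derivative zhdot t) (at t within {0..})) \<and>
         solves_integrated J wh
           (\<lambda>t. - \<sigma>0 * zh t - \<sigma>1 * zhdot t - Fv * w t + u t + K2 t * (w t - wh t)))"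

(* The state is the pair (e_z, e_w); the velocity w enters as a given time signal. *)
definition error_field ::
  "real \<Rightarrow> real \<Rightarrow> real \<Rightarrow> (real \<Rightarrow> real) \<Rightarrow> (real \<Rightarrow> real) \<Rightarrow> (real \<Rightarrow> real) \<Rightarrow> (real \<Rightarrow> real) \<Rightarrow>
   real \<Rightarrow> real \<times> real \<Rightarrow> real \<times> real"
where
  "error_field J \<sigma>0 \<sigma>1 h K1 K3 w t = (\<lambda>(ez, ew).
     (- \<sigma>0 * (\<bar>w t\<bar> / h (w t)) * ez - K1 t * ew,
      - (\<sigma>0 / J) * ez + (\<sigma>0 * \<sigma>1 / J) * (\<bar>w t\<bar> / h (w t)) * ez - K3 t * ew))"

definition solves_from :: "real \<Rightarrow> (real \<Rightarrow> 'a \<Rightarrow> 'a) \<Rightarrow> (real \<Rightarrow> 'a::real_normed_vector) \<Rightarrow> bool" where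
  "solves_from t0 f e \<longleftrightarrow> (\<forall>t\<ge>t0. (e has_vector_derivative f t (e t)) (at t within {t0..}))"

definition exponentially_stable :: "(real \<Rightarrow> 'a \<Rightarrow> 'a::real_normed_vector) \<Rightarrow> bool" where
  "exponentially_stable f \<longleftrightarrow>
     (\<exists>k>0. \<exists>\<delta>>0. \<forall>t0\<ge>0. \<forall>e. solves_from t0 f e \<longrightarrow>
        (\<forall>t\<ge>t0. norm (e t) \<le> k * exp (- \<delta> * (t - t0)) * norm (e t0)))"

end

theory Submission
  imports Defs
begin

text \<open>
  With \<open>r = \<bar>w\<bar> / h w \<ge> 0\<close> the function \<open>V = (A ez\<^sup>2 + C ew\<^sup>2) / 2\<close> decreases along the error
  dynamics, but only weakly when \<open>r\<close> is small. The cross term in \<open>V + \<epsilon> ez ew\<close> repairs this: the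
  derivative is the negative of a sum \<open>r Q\<^sub>1 + Q\<^sub>2\<close> of quadratic forms with constant coefficients,
  and for small \<open>\<epsilon> > 0\<close> the form \<open>Q\<^sub>1\<close> is nonnegative and \<open>Q\<^sub>2\<close> is positive definite. Hence the
  perturbed function decays exponentially, at a rate that does not depend on \<open>r\<close>.
\<close>

section \<open>Lyapunov criterion for exponential stability\<close>

lemma antimono_if_nonpos_derivative:
  fixes g :: "real \<Rightarrow> real"
  assumes "a \<le> b"
    and deriv: "\<And>s. s \<ge> a \<Longrightarrow> (g has_real_derivative g' s) (at s within {a..})"
    and nonpos: "\<And>s. s \<ge> a \<Longrightarrow> g' s \<le> 0"
  shows "g b \<le> g a"
proof (rule DERIV_nonpos_imp_decreasing_open[OF \<open>a \<le> b\<close>])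
  fix s assume "a < s" "s < b"
  \<comment> \<open>At interior points the derivative within the half-line is the ordinary one; at
    the end point \<open>a\<close> only continuity enters.\<close>
  then have "at s within {a..} = at s"
    by (intro at_within_interior) simp
  then have "(g has_real_derivative g' s) (at s)"
    using deriv[of s] \<open>a < s\<close> by simp
  then show "\<exists>y. (g has_real_derivative y) (at s) \<and> y \<le> 0"
    using nonpos[of s] \<open>a < s\<close> by auto
next
  have "continuous_on {a..} g"
    by (rule DERIV_continuous_on, rule deriv) simp
  then show "continuous_on {a..b} g"
    by (rule continuous_on_subset) auto
qed

text \<open>Along a solution, \<open>decay\<close> and \<open>upper\<close> give (d/ds) W <= -(c /
  L) W, so W times exp(c s / L) is nonincreasing. The two-sided comparison of W with the squared
  norm turns this into decay of the squared norm; the square root gives the constant sqrt (L / l)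
  and halves the rate to c / (2 L). Since \<open>decay\<close> is uniform in time, neither constant
  depends on \<open>t0\<close>.\<close>

lemma exponentially_stable_if_lyapunov:
  fixes f :: "real \<Rightarrow> 'a \<Rightarrow> 'a::real_normed_vector"
  assumes "l > 0" "L > 0" "c > 0"
    and deriv: "\<And>x. (W has_derivative W' x) (at x)"
    and lower: "\<And>x. l * (norm x)\<^sup>2 \<le> W x"
    and upper: "\<And>x. W x \<le> L * (norm x)\<^sup>2"
    and decay: "\<And>t x. t \<ge> 0 \<Longrightarrow> W' x (f t x) \<le> - c * (norm x)\<^sup>2"
  shows "exponentially_stable f"
  unfolding exponentially_stable_def
proof (rule exI[of _ "sqrt (L / l)"], intro conjI exI[of _ "c / (2 * L)"] allI impI)
  show "sqrt (L / l) > 0" "c / (2 * L) > 0"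
    using assms by simp_all
next
  fix t0 t :: real and e :: "real \<Rightarrow> 'a"
  assume "t0 \<ge> 0" "solves_from t0 f e" "t \<ge> t0"
  define \<mu> where "\<mu> = c / L"
  define g where "g s = exp (\<mu> * s) * W (e s)" for s
  have "g t \<le> g t0"
  proof (rule antimono_if_nonpos_derivative[OF \<open>t \<ge> t0\<close>])
    fix s assume "s \<ge> t0"
    have "(e has_derivative (\<lambda>h. h *\<^sub>R f s (e s))) (at s within {t0..})"
      using \<open>solves_from t0 f e\<close> \<open>s \<ge> t0\<close>
      by (simp add: solves_from_def has_vector_derivative_def)
    then have "((\<lambda>s. W (e s)) has_derivative (\<lambda>h. W' (e s) (h *\<^sub>R f s (e s)))) (at s within {t0..})"
      by (rule has_derivative_compose[OF _ deriv])
    \<comment> \<open>Linearity of \<open>W' (e s)\<close> pulls out the increment \<open>h\<close>,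
      so the derivative from the chain rule becomes multiplication by a number.\<close>
    moreover have "W' (e s) (h *\<^sub>R f s (e s)) = W' (e s) (f s (e s)) * h" for h
      using linear_cmul[OF has_derivative_linear[OF deriv]] by simp
    ultimately have "((\<lambda>s. W (e s)) has_real_derivative W' (e s) (f s (e s))) (at s within {t0..})"
      by (simp add: has_field_derivative_def)
    then show "(g has_real_derivative exp (\<mu> * s) * (\<mu> * W (e s) + W' (e s) (f s (e s))))
        (at s within {t0..})"
      unfolding g_def by (auto intro!: derivative_eq_intros simp: algebra_simps)
    have "\<mu> * W (e s) \<le> \<mu> * (L * (norm (e s))\<^sup>2)"
      using upper assms by (intro mult_left_mono) (auto simp: \<mu>_def)
    also have "\<dots> = c * (norm (e s))\<^sup>2"
      using \<open>L > 0\<close> by (simp add: \<mu>_def)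
    finally have "\<mu> * W (e s) + W' (e s) (f s (e s)) \<le> 0"
      using decay[of s "e s"] \<open>t0 \<ge> 0\<close> \<open>s \<ge> t0\<close> by simp
    then show "exp (\<mu> * s) * (\<mu> * W (e s) + W' (e s) (f s (e s))) \<le> 0"
      by (simp add: mult_le_0_iff)
  qed
  \<comment> \<open>Multiplying by \<open>exp (- \<mu> * t)\<close> removes the weight at time
    \<open>t\<close> and leaves the decay factor over the elapsed time \<open>t - t0\<close> on the
    right.\<close>
  then have "exp (- \<mu> * t) * g t \<le> exp (- \<mu> * t) * g t0"
    by (intro mult_left_mono) auto
  moreover have "exp (- \<mu> * t) * g t = W (e t)"
    by (simp add: g_def exp_minus)
  moreover have "exp (- \<mu> * t) * g t0 = exp (- \<mu> * (t - t0)) * W (e t0)"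
    by (simp add: g_def exp_minus exp_diff right_diff_distrib divide_inverse)
  ultimately have "W (e t) \<le> exp (- \<mu> * (t - t0)) * W (e t0)"
    by (simp only:)
  also have "\<dots> \<le> exp (- \<mu> * (t - t0)) * (L * (norm (e t0))\<^sup>2)"
    using upper by (intro mult_left_mono) auto
  finally have "l * (norm (e t))\<^sup>2 \<le> exp (- \<mu> * (t - t0)) * (L * (norm (e t0))\<^sup>2)"
    using lower[of "e t"] by linarith
  then have "(norm (e t))\<^sup>2 \<le> L / l * exp (- \<mu> * (t - t0)) * (norm (e t0))\<^sup>2"
    using \<open>l > 0\<close> by (simp add: field_simps)
  also have "\<dots> = (sqrt (L / l) * exp (- (c / (2 * L)) * (t - t0)) * norm (e t0))\<^sup>2"
    using assms by (simp add: power_mult_distrib \<mu>_def exp_double[symmetric] field_simps)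
  finally show "norm (e t) \<le> sqrt (L / l) * exp (- (c / (2 * L)) * (t - t0)) * norm (e t0)"
    by (rule power2_le_imp_le) (use assms in auto)
qed

text \<open>The exponential bound with initial time 0 squeezes the norm to zero. This is how
  convergence of the velocity error is read off from stability.\<close>

lemma tendsto_zero_if_exponentially_stable:
  assumes "exponentially_stable f" "solves_from 0 f e"
  shows "(e \<longlongrightarrow> 0) at_top"
proof -
  obtain k \<delta> where "\<delta> > 0"
    and bound: "\<And>t. t \<ge> 0 \<Longrightarrow> norm (e t) \<le> k * exp (- \<delta> * (t - 0)) * norm (e 0)"
    using assms unfolding exponentially_stable_def by blast
  have "((\<lambda>t. k * exp (- \<delta> * (t - 0)) * norm (e 0)) \<longlongrightarrow> k * 0 * norm (e 0)) at_top"
    by (intro tendsto_intros filterlim_compose[OF exp_at_bot])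
      (use \<open>\<delta> > 0\<close> in \<open>simp add: filterlim_uminus_at_bot filterlim_tendsto_pos_mult_at_top[OF tendsto_const _ filterlim_ident]\<close>)
  then show ?thesis
    by (intro Lim_null_comparison[of e "\<lambda>t. k * exp (- \<delta> * (t - 0)) * norm (e 0)"])
      (use bound in \<open>auto simp: eventually_at_top_linorder\<close>)
qed

section \<open>Strict Lyapunov function for the error dynamics\<close>

lemma quadratic_form_nonneg:
  fixes a b c x y :: real
  assumes "a > 0" "b\<^sup>2 \<le> 4 * a * c"
  shows "a * x\<^sup>2 + b * (x * y) + c * y\<^sup>2 \<ge> 0"
proof -
  \<comment> \<open>Completing the square, after scaling by 4 a to avoid fractions.\<close>
  have "4 * a * (a * x\<^sup>2 + b * (x * y) + c * y\<^sup>2) = (2 * a * x + b * y)\<^sup>2 + (4 * a * c - b\<^sup>2) * y\<^sup>2"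
    by (simp add: power2_eq_square algebra_simps)
  also have "\<dots> \<ge> 0"
    using assms by (intro add_nonneg_nonneg mult_nonneg_nonneg) auto
  finally show ?thesis
    using \<open>a > 0\<close> by (simp add: zero_le_mult_iff)
qed

text \<open>The left side of the estimate is the derivative of A x^2 / 2 + C y^2 / 2 + \<epsilon> x
  y along the error field, with x, y for the two errors and \<open>r\<close> for |w| / h(w). Without
  the cross term it equals -A \<sigma>0 r x^2 - (C \<alpha> / J) y^2, which gives no decay in x
  where r = 0. The cross term contributes -\<epsilon> (\<sigma>0 / J) x^2 whatever r is, and its
  other terms are absorbed for small \<epsilon>. The bounds by A / 2 and C / 2 keep the function
  comparable to the squared norm.\<close>

lemma exists_cross_weight:
  fixes J \<sigma>0 \<sigma>1 A C \<alpha> :: real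
  assumes pos: "J > 0" "\<sigma>0 > 0" "\<sigma>1 > 0" "A > 0" "C > 0" "\<alpha> > 0"
  obtains \<epsilon> c where "\<epsilon> > 0" "c > 0" "\<epsilon> \<le> A / 2" "\<epsilon> \<le> C / 2"
    and "\<And>r x y. r \<ge> 0 \<Longrightarrow>
      (A * x + \<epsilon> * y) * (- \<sigma>0 * r * x - C * \<sigma>0 / (A * J) * (\<sigma>1 * r - 1) * y)
      + (C * y + \<epsilon> * x) * (- (\<sigma>0 / J) * x + \<sigma>0 * \<sigma>1 / J * r * x - \<alpha> / J * y)
      \<le> - c * (x\<^sup>2 + y\<^sup>2)"
proof -
  define p where "p = \<sigma>0 / J"
  define q where "q = \<sigma>0 * \<sigma>1 / J"
  define \<kappa> where "\<kappa> = C / A"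
  define \<beta> where "\<beta> = \<alpha> / J"
  have pos': "p > 0" "q > 0" "\<kappa> > 0" "\<beta> > 0"
    using pos by (simp_all add: p_def q_def \<kappa>_def \<beta>_def)
  \<comment> \<open>\<open>\<epsilon>1\<close> and \<open>\<epsilon>2\<close> are the thresholds
    from solving the discriminant conditions \<open>disc1\<close> and \<open>disc2\<close> for
    \<epsilon>. \<open>\<epsilon>3\<close> keeps the leading coefficient of the first form positive;
    its factor 1/2 makes this strict.\<close>
  define \<epsilon>1 where "\<epsilon>1 = 4 * (A * \<sigma>0) * \<kappa> * q / (\<sigma>0\<^sup>2 + 4 * \<kappa> * q\<^sup>2)"
  define \<epsilon>2 where "\<epsilon>2 = p * (C * \<beta>) / (\<beta>\<^sup>2 + 2 * \<kappa> * p\<^sup>2)"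
  define \<epsilon>3 where "\<epsilon>3 = A * \<sigma>0 / (2 * q)"
  have den: "\<sigma>0\<^sup>2 + 4 * \<kappa> * q\<^sup>2 > 0" "\<beta>\<^sup>2 + 2 * \<kappa> * p\<^sup>2 > 0"
    using pos pos' by (simp_all add: add_pos_pos)
  define \<epsilon> where "\<epsilon> = Min {\<epsilon>1, \<epsilon>2, \<epsilon>3, A / 2, C / 2}"
  have "\<epsilon> > 0"
    using pos pos' den by (simp add: \<epsilon>_def \<epsilon>1_def \<epsilon>2_def \<epsilon>3_def)
  have le: "\<epsilon> \<le> \<epsilon>1" "\<epsilon> \<le> \<epsilon>2" "\<epsilon> \<le> \<epsilon>3" "\<epsilon> \<le> A / 2" "\<epsilon> \<le> C / 2"
    by (simp_all add: \<epsilon>_def)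
  define c where "c = min (\<epsilon> * p / 2) (C * \<beta> / 2)"
  have "c > 0"
    using pos pos' \<open>\<epsilon> > 0\<close> by (simp add: c_def)
  have "\<epsilon> * q < A * \<sigma>0"
  proof -
    have "\<epsilon> * q \<le> A * \<sigma>0 / 2"
      using le(3) pos' by (simp add: \<epsilon>3_def field_simps)
    also have "\<dots> < A * \<sigma>0"
      using pos by simp
    finally show ?thesis .
  qed
  have disc1: "(\<epsilon> * \<sigma>0)\<^sup>2 \<le> 4 * (A * \<sigma>0 - \<epsilon> * q) * (\<epsilon> * \<kappa> * q)"
  proof -
    have "\<epsilon> * (\<sigma>0\<^sup>2 + 4 * \<kappa> * q\<^sup>2) \<le> 4 * (A * \<sigma>0) * \<kappa> * q"
      using le(1) den(1) unfolding \<epsilon>1_def by (simp add: pos_le_divide_eq)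
    then have "\<epsilon> * (\<epsilon> * (\<sigma>0\<^sup>2 + 4 * \<kappa> * q\<^sup>2)) \<le> \<epsilon> * (4 * (A * \<sigma>0) * \<kappa> * q)"
      using \<open>\<epsilon> > 0\<close> by (intro mult_left_mono) auto
    then show ?thesis
      by (simp add: power2_eq_square algebra_simps)
  qed
  have disc2: "(\<epsilon> * \<beta>)\<^sup>2 \<le> 4 * (\<epsilon> * p / 2) * (C * \<beta> / 2 - \<epsilon> * \<kappa> * p)"
  proof -
    have "\<epsilon> * (\<beta>\<^sup>2 + 2 * \<kappa> * p\<^sup>2) \<le> p * (C * \<beta>)"
      using le(2) den(2) unfolding \<epsilon>2_def by (simp add: pos_le_divide_eq)
    then have "\<epsilon> * (\<epsilon> * (\<beta>\<^sup>2 + 2 * \<kappa> * p\<^sup>2)) \<le> \<epsilon> * (p * (C * \<beta>))"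
      using \<open>\<epsilon> > 0\<close> by (intro mult_left_mono) auto
    then show ?thesis
      by (simp add: power2_eq_square algebra_simps)
  qed
  show thesis
  proof (rule that[OF \<open>\<epsilon> > 0\<close> \<open>c > 0\<close> le(4,5)])
    fix r x y :: real
    assume "r \<ge> 0"
    let ?Q1 = "(A * \<sigma>0 - \<epsilon> * q) * x\<^sup>2 + \<epsilon> * \<sigma>0 * (x * y) + \<epsilon> * \<kappa> * q * y\<^sup>2"
    \<comment> \<open>\<open>?Q1\<close> collects the terms with factor r. From the rest, half of
      \<epsilon> p x^2 and half of C \<beta> y^2 are kept out of \<open>?Q2\<close>; they supply the
      decay, and \<open>c\<close> is the smaller of their coefficients.\<close>
    let ?Q2 = "\<epsilon> * p / 2 * x\<^sup>2 + \<epsilon> * \<beta> * (x * y) + (C * \<beta> / 2 - \<epsilon> * \<kappa> * p) * y\<^sup>2"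
    \<comment> \<open>The gain K1 is \<kappa> times the coefficient q r - p of x in the velocity
      equation. As A \<kappa> = C, the mixed terms weighted by A and by C cancel.\<close>
    have gain: "C * \<sigma>0 / (A * J) * (\<sigma>1 * r - 1) = \<kappa> * (q * r - p)"
      using pos by (simp add: p_def q_def \<kappa>_def field_simps)
    have A\<kappa>: "A * \<kappa> = C"
      using pos by (simp add: \<kappa>_def)
    have "(A * x + \<epsilon> * y) * (- \<sigma>0 * r * x - C * \<sigma>0 / (A * J) * (\<sigma>1 * r - 1) * y)
      + (C * y + \<epsilon> * x) * (- (\<sigma>0 / J) * x + \<sigma>0 * \<sigma>1 / J * r * x - \<alpha> / J * y)
      = (A * x + \<epsilon> * y) * (- \<sigma>0 * r * x - \<kappa> * (q * r - p) * y)
      + (A * \<kappa> * y + \<epsilon> * x) * (- p * x + q * r * x - \<beta> * y)"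
      unfolding gain A\<kappa> by (simp add: p_def q_def \<beta>_def)
    also have "\<dots> = - (r * ?Q1 + ?Q2 + (\<epsilon> * p / 2 * x\<^sup>2 + C * \<beta> / 2 * y\<^sup>2))"
      unfolding A\<kappa>[symmetric] by (simp add: power2_eq_square field_simps)
    also have "\<dots> \<le> - (\<epsilon> * p / 2 * x\<^sup>2 + C * \<beta> / 2 * y\<^sup>2)"
    proof -
      have "r * ?Q1 \<ge> 0"
        using \<open>r \<ge> 0\<close> \<open>\<epsilon> * q < A * \<sigma>0\<close> disc1
        by (intro mult_nonneg_nonneg quadratic_form_nonneg) auto
      moreover have "?Q2 \<ge> 0"
        using pos' \<open>\<epsilon> > 0\<close> disc2 by (intro quadratic_form_nonneg) auto
      ultimately show ?thesis by linarith
    qed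
    also have "\<dots> \<le> - (c * x\<^sup>2 + c * y\<^sup>2)"
      unfolding neg_le_iff_le by (intro add_mono mult_right_mono) (auto simp: c_def)
    finally show "(A * x + \<epsilon> * y) * (- \<sigma>0 * r * x - C * \<sigma>0 / (A * J) * (\<sigma>1 * r - 1) * y)
      + (C * y + \<epsilon> * x) * (- (\<sigma>0 / J) * x + \<sigma>0 * \<sigma>1 / J * r * x - \<alpha> / J * y)
      \<le> - c * (x\<^sup>2 + y\<^sup>2)"
      by (simp add: algebra_simps)
  qed
qed

text \<open>The estimate with the cross weight holds for every r >= 0 with the same constants, so it
  can be applied at each time with r = |w| / h(w). Thus \<open>W\<close> satisfies the Lyapunov
  criterion although the system varies in time.\<close>

lemma error_field_exponentially_stable:
  fixes J \<sigma>0 \<sigma>1 A C \<alpha> :: real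
  assumes pos: "J > 0" "\<sigma>0 > 0" "\<sigma>1 > 0" "A > 0" "C > 0" "\<alpha> > 0"
    and h_pos: "\<And>v. h v > 0"
  shows "exponentially_stable (error_field J \<sigma>0 \<sigma>1 h
    (\<lambda>t. C * \<sigma>0 / (A * J) * (\<sigma>1 * (\<bar>w t\<bar> / h (w t)) - 1)) (\<lambda>t. \<alpha> / J) w)"
proof -
  obtain \<epsilon> c where "\<epsilon> > 0" "c > 0" and \<epsilon>: "\<epsilon> \<le> A / 2" "\<epsilon> \<le> C / 2"
    and decay: "\<And>r x y. r \<ge> 0 \<Longrightarrow>
      (A * x + \<epsilon> * y) * (- \<sigma>0 * r * x - C * \<sigma>0 / (A * J) * (\<sigma>1 * r - 1) * y)
      + (C * y + \<epsilon> * x) * (- (\<sigma>0 / J) * x + \<sigma>0 * \<sigma>1 / J * r * x - \<alpha> / J * y)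
      \<le> - c * (x\<^sup>2 + y\<^sup>2)"
    using exists_cross_weight[OF pos] by blast
  define W where "W e = A / 2 * (fst e)\<^sup>2 + C / 2 * (snd e)\<^sup>2 + \<epsilon> * (fst e * snd e)"
    for e :: "real \<times> real"
  define W' where "W' e d = (A * fst e + \<epsilon> * snd e) * fst d + (C * snd e + \<epsilon> * fst e) * snd d"
    for e d :: "real \<times> real"
  have norm_sq: "(norm e)\<^sup>2 = (fst e)\<^sup>2 + (snd e)\<^sup>2" for e :: "real \<times> real"
    by (cases e) (simp add: norm_Pair)
  \<comment> \<open>The cross term is at most half of A x^2 / 2 + C y^2 / 2, which yields both the
    lower and the upper bound on \<open>W\<close>.\<close>
  have cross: "\<bar>\<epsilon> * (x * y)\<bar> \<le> A / 4 * x\<^sup>2 + C / 4 * y\<^sup>2" for x y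
  proof -
    have "2 * \<bar>x * y\<bar> \<le> x\<^sup>2 + y\<^sup>2"
      using sum_squares_bound[of "\<bar>x\<bar>" "\<bar>y\<bar>"] by (simp add: abs_mult)
    then have "\<epsilon> * (2 * \<bar>x * y\<bar>) \<le> \<epsilon> * (x\<^sup>2 + y\<^sup>2)"
      using \<open>\<epsilon> > 0\<close> by (intro mult_left_mono) auto
    moreover have "\<epsilon> * x\<^sup>2 \<le> A / 2 * x\<^sup>2" "\<epsilon> * y\<^sup>2 \<le> C / 2 * y\<^sup>2"
      by (rule mult_right_mono[OF \<epsilon>(1)], simp) (rule mult_right_mono[OF \<epsilon>(2)], simp)
    ultimately show ?thesis
      using \<open>\<epsilon> > 0\<close> by (simp add: abs_mult algebra_simps)
  qed
  show ?thesis
  proof (rule exponentially_stable_if_lyapunov)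
    show "min A C / 4 > 0" "A + C > 0" "c > 0"
      using pos \<open>c > 0\<close> by auto
    show "(W has_derivative W' e) (at e)" for e
      unfolding W_def W'_def
      by (auto intro!: derivative_eq_intros simp: fun_eq_iff algebra_simps)
    show "min A C / 4 * (norm e)\<^sup>2 \<le> W e" for e
    proof -
      have "min A C / 4 * (norm e)\<^sup>2 \<le> A / 4 * (fst e)\<^sup>2 + C / 4 * (snd e)\<^sup>2"
        unfolding norm_sq distrib_left by (intro add_mono mult_right_mono) auto
      then show ?thesis
        using cross[of "fst e" "snd e"] by (simp add: W_def)
    qed
    show "W e \<le> (A + C) * (norm e)\<^sup>2" for e
    proof -
      have "A * (fst e)\<^sup>2 + C * (snd e)\<^sup>2 \<le> (A + C) * (norm e)\<^sup>2"
        unfolding norm_sq distrib_left using pos by (intro add_mono mult_right_mono) auto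
      moreover have "A * (fst e)\<^sup>2 \<ge> 0" "C * (snd e)\<^sup>2 \<ge> 0"
        using pos by auto
      ultimately show ?thesis
        using cross[of "fst e" "snd e"] by (simp add: W_def)
    qed
    show "W' e (error_field J \<sigma>0 \<sigma>1 h
        (\<lambda>t. C * \<sigma>0 / (A * J) * (\<sigma>1 * (\<bar>w t\<bar> / h (w t)) - 1)) (\<lambda>t. \<alpha> / J) w t e)
      \<le> - c * (norm e)\<^sup>2" for t e
      using decay[of "\<bar>w t\<bar> / h (w t)" "fst e" "snd e"] h_pos[of "w t"]
      unfolding W'_def norm_sq error_field_def case_prod_beta fst_conv snd_conv
      by simp
  qed
qed

section \<open>Friction curve and equations in integrated form\<close>

lemma stribeck_pos:
  assumes "Fc > 0" "Fs > 0"
  shows "stribeck Fc Fs ws v > 0"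
proof -
  define E where "E = exp (- ((v / ws)\<^sup>2))"
  have E: "0 < E" "E \<le> 1"
    by (simp_all add: E_def)
  \<comment> \<open>The Stribeck curve is the convex combination (1 - E) Fc + E Fs, hence positive
    whichever of the two levels is larger.\<close>
  have "Fc * (1 - E) \<ge> 0" "Fs * E > 0"
    using assms E by simp_all
  then show ?thesis
    unfolding stribeck_def E_def[symmetric] by (simp add: algebra_simps)
qed

lemma continuous_on_stribeck [continuous_intros]:
  "continuous_on S f \<Longrightarrow> continuous_on S (\<lambda>t. stribeck Fc Fs ws (f t))"
  unfolding stribeck_def divide_inverse by (intro continuous_intros)

text \<open>Bridges the facts on indefinite integrals, which concern compact intervals, and the
  trajectories, which live on a half-line.\<close>

lemma at_within_atLeastAtMost_eq_atLeast:
  fixes t b :: real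
  assumes "t < b"
  shows "at t within {a..b} = at t within {a..}"
  by (rule at_within_nhd[of _ "{..<b}"]) (use assms in auto)

text \<open>The solution is a constant plus an indefinite integral divided by \<open>c\<close>, and
  an indefinite integral is continuous even if its integrand is not. This covers the velocities
  under a discontinuous input.\<close>

lemma continuous_on_if_solves_integrated:
  assumes "solves_integrated c x f" "c \<noteq> 0"
  shows "continuous_on {0..} x"
  unfolding continuous_on_eq_continuous_within
proof
  fix t :: real
  assume "t \<in> {0..}"
  have int: "(f has_integral c * (x s - x 0)) {0..s}" if "s \<ge> 0" for s
    using assms that by (simp add: solves_integrated_def)
  \<comment> \<open>The window ends at \<open>t + 1\<close> so that \<open>t\<close> is not its
    right end point.\<close>
  have "continuous_on {0..t + 1} (\<lambda>s. x 0 + integral {0..s} f / c)"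
    using int[of "t + 1"] \<open>t \<in> {0..}\<close> assms
    by (intro continuous_intros indefinite_integral_continuous_1) (auto simp: integrable_on_def)
  moreover have "x 0 + integral {0..s} f / c = x s" if "s \<in> {0..t + 1}" for s
    using integral_unique[OF int[of s]] that assms by simp
  ultimately have "continuous_on {0..t + 1} x"
    by (rule continuous_on_eq) simp
  then have "continuous (at t within {0..t + 1}) x"
    using \<open>t \<in> {0..}\<close> by (simp add: continuous_on_eq_continuous_within)
  then show "continuous (at t within {0..}) x"
    by (simp add: at_within_atLeastAtMost_eq_atLeast)
qed

text \<open>For a continuous right-hand side the fundamental theorem of calculus recovers the
  classical differential equation.\<close>

lemma has_derivative_if_solves_integrated:
  assumes "solves_integrated c x f" "c \<noteq> 0" "continuous_on {0..} f" "t \<ge> 0"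
  shows "(x has_real_derivative f t / c) (at t within {0..})"
proof -
  have int: "(f has_integral c * (x s - x 0)) {0..s}" if "s \<ge> 0" for s
    using assms that by (simp add: solves_integrated_def)
  have "((\<lambda>s. integral {0..s} f) has_vector_derivative f t) (at t within {0..t + 1})"
    using assms by (intro integral_has_vector_derivative continuous_on_subset[OF assms(3)]) auto
  then have "((\<lambda>s. integral {0..s} f) has_real_derivative f t) (at t within {0..})"
    by (simp add: has_real_derivative_iff_has_vector_derivative at_within_atLeastAtMost_eq_atLeast)
  then have "((\<lambda>s. x 0 + integral {0..s} f / c) has_real_derivative f t / c) (at t within {0..})"
    using assms by (auto intro!: derivative_eq_intros)
  then show ?thesis
  proof (rule has_field_derivative_transform_within[OF _ zero_less_one])
    show "x 0 + integral {0..s} f / c = x s" if "s \<in> {0..}" for s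
      using integral_unique[OF int[of s]] that assms by simp
  qed (use assms in auto)
qed

section \<open>The observer error as a solution of the error dynamics\<close>

lemma solves_integrated_diff:
  assumes "solves_integrated c x f" "solves_integrated c y g"
  shows "solves_integrated c (\<lambda>t. x t - y t) (\<lambda>t. f t - g t)"
  unfolding solves_integrated_def
proof (intro allI impI)
  fix t :: real
  assume "t \<ge> 0"
  then have "((\<lambda>t. f t - g t) has_integral c * (x t - x 0) - c * (y t - y 0)) {0..t}"
    using assms by (intro has_integral_diff) (auto simp: solves_integrated_def)
  then show "((\<lambda>t. f t - g t) has_integral c * (x t - y t - (x 0 - y 0))) {0..t}"
    by (simp add: algebra_simps)
qed

text \<open>The input \<open>u\<close> cancels when the velocity equations are subtracted. The
  remaining right-hand side involves only continuous signals, so the velocity error is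
  differentiable even where the velocities themselves are not. Continuity of \<open>w\<close> and of
  the velocity error comes first, from the integrated equations; differentiability follows from
  it.\<close>

lemma observer_error_solves:
  fixes J \<sigma>0 \<sigma>1 :: real
  assumes "J > 0"
    and h: "\<And>v. h v > 0" "continuous_on UNIV h"
    and gain: "continuous_on {0..} (\<lambda>t. K2 t - \<sigma>1 * K1 t)"
    and plant: "lugre_trajectory J \<sigma>0 \<sigma>1 Fv h u w z"
    and observer: "observer_trajectory J \<sigma>0 \<sigma>1 Fv h K1 K2 u w zh wh"
  shows "solves_from 0 (error_field J \<sigma>0 \<sigma>1 h K1 (\<lambda>t. (K2 t - \<sigma>1 * K1 t) / J) w)
    (\<lambda>t. (z t - zh t, w t - wh t))"
proof -
  define r where "r t = \<bar>w t\<bar> / h (w t)" for t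
  have z: "(z has_real_derivative w t - \<sigma>0 * r t * z t) (at t within {0..})" if "t \<ge> 0" for t
    using plant that by (simp add: lugre_trajectory_def Let_def bristle_rate_def r_def)
  have zh: "(zh has_real_derivative w t - \<sigma>0 * r t * zh t + K1 t * (w t - wh t)) (at t within {0..})"
    if "t \<ge> 0" for t
    using observer that by (simp add: observer_trajectory_def Let_def bristle_rate_def r_def)
  have w: "solves_integrated J w
      (\<lambda>t. - (\<sigma>0 * z t + \<sigma>1 * (w t - \<sigma>0 * r t * z t) + Fv * w t) + u t)"
    using plant unfolding lugre_trajectory_def Let_def bristle_rate_def r_def by blast
  have wh: "solves_integrated J wh (\<lambda>t. - \<sigma>0 * zh t
      - \<sigma>1 * (w t - \<sigma>0 * r t * zh t + K1 t * (w t - wh t)) - Fv * w t + u t + K2 t * (w t - wh t))"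
    using observer unfolding observer_trajectory_def Let_def bristle_rate_def r_def by blast
  let ?ez = "\<lambda>t. z t - zh t" and ?ew = "\<lambda>t. w t - wh t"
  let ?f = "\<lambda>t. - \<sigma>0 * ?ez t + \<sigma>0 * \<sigma>1 * r t * ?ez t - (K2 t - \<sigma>1 * K1 t) * ?ew t"
  \<comment> \<open>Besides \<open>u\<close>, the terms in Fv w and \<sigma>1 w cancel. The K1 term
    inside the damping of the observer combines with K2 to K2 - \<sigma>1 K1.\<close>
  have ew: "solves_integrated J ?ew ?f"
    using solves_integrated_diff[OF w wh] by (simp add: algebra_simps)
  have ez: "(?ez has_real_derivative - \<sigma>0 * r t * ?ez t - K1 t * ?ew t) (at t within {0..})"
    if "t \<ge> 0" for t
    using DERIV_diff[OF z zh, OF that that] by (simp add: algebra_simps)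
  have "continuous_on {0..} w" "continuous_on {0..} ?ew"
    using continuous_on_if_solves_integrated w ew \<open>J > 0\<close> by blast+
  moreover have "continuous_on {0..} ?ez"
    by (rule DERIV_continuous_on, rule ez) simp
  moreover have "continuous_on {0..} r"
    unfolding r_def
    using \<open>continuous_on {0..} w\<close> h(1) continuous_on_compose2[OF h(2)]
    by (intro continuous_intros) (auto simp: less_imp_neq[symmetric])
  \<comment> \<open>Arbitrary \<open>x\<close>, \<open>k\<close>, \<open>y\<close> make the
    continuity rules treat the errors and the gain difference as wholes instead of splitting them
    into their constituents.\<close>
  moreover have "continuous_on {0..} (\<lambda>t. - \<sigma>0 * x t + \<sigma>0 * \<sigma>1 * r t * x t - k t * y t)"
    if "continuous_on {0..} r" "continuous_on {0..} x" "continuous_on {0..} k" "continuous_on {0..} y"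
    for x k y :: "real \<Rightarrow> real"
    using that by (intro continuous_intros)
  ultimately have "continuous_on {0..} ?f"
    using gain by blast
  then have "(?ew has_real_derivative ?f t / J) (at t within {0..})" if "t \<ge> 0" for t
    using has_derivative_if_solves_integrated[OF ew] \<open>J > 0\<close> that by simp
  moreover have "?f t / J = - (\<sigma>0 / J) * ?ez t + \<sigma>0 * \<sigma>1 / J * r t * ?ez t
      - (K2 t - \<sigma>1 * K1 t) / J * ?ew t" for t
    using \<open>J > 0\<close> by (simp add: field_simps)
  ultimately show ?thesis
    using ez
    unfolding solves_from_def error_field_def r_def case_prod_conv
      has_real_derivative_iff_has_vector_derivative
    by (auto intro!: has_vector_derivative_Pair)
qed

section \<open>Convergence and stability of the LuGre observer\<close>

theorem lemma4:
  fixes J \<sigma>0 \<sigma>1 Fc Fs Fv ws A C \<alpha> :: real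
    and h u w z K1 K2 K3 :: "real \<Rightarrow> real"
  assumes "J > 0" "\<sigma>0 > 0" "\<sigma>1 > 0" "Fc > 0" "Fs > 0" "ws > 0"
    and "A > 0" "C > 0" "\<alpha> > 0"
    and h: "h = stribeck Fc Fs ws"
    and plant: "lugre_trajectory J \<sigma>0 \<sigma>1 Fv h u w z"
    and K1: "K1 = (\<lambda>t. C * \<sigma>0 / (A * J) * (\<sigma>1 * (\<bar>w t\<bar> / h (w t)) - 1))"
    and K2: "K2 = (\<lambda>t. \<alpha> + \<sigma>1 * K1 t)"
    and K3: "K3 = (\<lambda>t. (K2 t - \<sigma>1 * K1 t) / J)"
  shows "(\<forall>zh wh. observer_trajectory J \<sigma>0 \<sigma>1 Fv h K1 K2 u w zh wh \<longrightarrow>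
             solves_from 0 (error_field J \<sigma>0 \<sigma>1 h K1 K3 w) (\<lambda>t. (z t - zh t, w t - wh t)))
       \<and> (bounded (w ` {0..}) \<longrightarrow>
            (\<forall>zh wh. observer_trajectory J \<sigma>0 \<sigma>1 Fv h K1 K2 u w zh wh \<longrightarrow>
               ((\<lambda>t. w t - wh t) \<longlongrightarrow> 0) at_top))
       \<and> ((\<exists>a>0. \<forall>t\<ge>0. \<bar>w t\<bar> \<ge> a) \<or>
            (\<exists>T>0. \<exists>b>0. \<forall>t\<ge>0. integral {t..t + T} (\<lambda>\<tau>. \<bar>w \<tau>\<bar>) \<ge> b) \<longrightarrow>
            exponentially_stable (error_field J \<sigma>0 \<sigma>1 h K1 K3 w))"
proof -
  let ?E = "error_field J \<sigma>0 \<sigma>1 h K1 K3 w"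
  have h_pos: "h v > 0" for v
    unfolding h using \<open>Fc > 0\<close> \<open>Fs > 0\<close> by (rule stribeck_pos)
  have h_cont: "continuous_on UNIV h"
    unfolding h by (intro continuous_intros)
  \<comment> \<open>The choice of K2 makes K2 - \<sigma>1 K1 the constant \<alpha>. This gives the
    constant damping in the error field and, below, the continuity required of the gain
    difference.\<close>
  have "K3 = (\<lambda>t. \<alpha> / J)"
    by (simp add: K3 K2)
  then have stable: "exponentially_stable ?E"
    unfolding K1 using assms h_pos by (simp only: error_field_exponentially_stable)
  have "continuous_on {0..} (\<lambda>t. K2 t - \<sigma>1 * K1 t)"
    by (simp add: K2)
  then have error: "solves_from 0 ?E (\<lambda>t. (z t - zh t, w t - wh t))"
    if "observer_trajectory J \<sigma>0 \<sigma>1 Fv h K1 K2 u w zh wh" for zh wh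
    unfolding K3 using observer_error_solves[OF \<open>J > 0\<close> h_pos h_cont _ plant that] by simp
  \<comment> \<open>The error pair solves an exponentially stable system and so tends to zero; its
    second component is the velocity error.\<close>
  then have "((\<lambda>t. w t - wh t) \<longlongrightarrow> 0) at_top"
    if "observer_trajectory J \<sigma>0 \<sigma>1 Fv h K1 K2 u w zh wh" for zh wh
    using tendsto_snd[OF tendsto_zero_if_exponentially_stable[OF stable error[OF that]]] by simp
  then show ?thesis
    using error stable by blast
qed

end
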